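(* Let $\gamma\colon (0,\sqrt{2}) \to (0,1]$ be the function defined in the context. Let $c \in (0,\sqrt{2})$, let $\alpha \in (0,1]$, let $d \geq 2$ be an integer, and set $\beta = 1-2d\big(1-\alpha\cdot \gamma(c)\big)^{1/(2d)}$. Assume that $\mathcal{F}_1, \ldots, \mathcal{F}_{2d}$ are finite families of convex sets in $\mathbb{R}^d$ and set $N = \prod_{i=1}^{2d} |\mathcal{F}_i|$. If $\bigcap_{i=1}^{2d}F_i$ has diameter greater than or equal to $1$ for at least $\alpha N$ different $2d$-tuples $(F_i)_{i=1}^{2d}$ with $F_i \in \mathcal{F}_i$ for each $i$, then there exist an index $k\in \{1,\dots,2d\}$ and a subfamily $\mathcal G \subseteq \mathcal{F}_k$ such that $|\mathcal G| \ge \beta |\mathcal{F}_k|$ and the diameter of $\bigcap \mathcal G$ is greater than or equal to $c\, d^{-1/2}$.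
   Context: Diameter is measured in the Euclidean norm: the diameter of a set is the supremum of the distances between pairs of its points. For a family $\mathcal G$ of sets, $\bigcap\mathcal G$ denotes the intersection of all its members (so the intersection of the empty family is $\mathbb{R}^d$). Definition of $\gamma$: let $B_d$ be the Euclidean unit ball in $\mathbb{R}^d$ centered at the origin and let $r_d$ be the radius of a ball of volume one in $\mathbb{R}^d$. For a ball $B$ centered at the origin, $t>0$, and a unit vector $u$, the $t$-cap of $B$ in direction $u$ is $C(B,t,u) = \{x\in B : \langle x,u\rangle \ge t\}$. For $c\in(0,\sqrt2)$ define $$\gamma(c) = \inf_{d\ge 2} \operatorname{vol}\left[ C\!\left(r_d B_d, \frac{c\, r_d}{\sqrt d}, u\right)\cup C\!\left(r_d B_d, \frac{c\, r_d}{\sqrt d}, -u\right)\right],$$ where $\operatorname{vol}$ is $d$-dimensional volume and $u$ is an arbitrary unit vector in $\mathbb{R}^d$ (the volume does not depend on $u$). Equivalently, $\gamma(c)$ is the infimum over $d\ge2$ of the fraction of the volume of $B_d$ occupied by the two opposite caps $C(B_d, c/\sqrt d,\pm u)$. *)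

theory Defs
  imports "HOL-Analysis.Analysis"
begin

text \<open>
  The function \<open>\<gamma>\<close> is an infimum over all dimensions \<open>d \<ge> 2\<close>, so it cannot be stated with the
  dimension encoded in a type. For its definition, the space \<open>\<real>\<^sup>d\<close> is the space of
  the product measure of \<open>d\<close> copies of \<open>lborel\<close>: functions on \<open>{..<d}\<close> (extended by
  \<open>undefined\<close> outside of that set).
\<close>

definition R_space :: "nat \<Rightarrow> (nat \<Rightarrow> real) measure" where
  "R_space d = Pi\<^sub>M {..<d} (\<lambda>_. lborel)"

definition R_inner :: "nat \<Rightarrow> (nat \<Rightarrow> real) \<Rightarrow> (nat \<Rightarrow> real) \<Rightarrow> real" where
  "R_inner d x y = (\<Sum>i<d. x i * y i)"

definition R_norm :: "nat \<Rightarrow> (nat \<Rightarrow> real) \<Rightarrow> real" where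
  "R_norm d x = sqrt (R_inner d x x)"

definition R_cball :: "nat \<Rightarrow> real \<Rightarrow> (nat \<Rightarrow> real) set" where
  "R_cball d r = {x \<in> space (R_space d). R_norm d x \<le> r}"

definition R_sphere :: "nat \<Rightarrow> (nat \<Rightarrow> real) set" where
  "R_sphere d = {u \<in> space (R_space d). R_norm d u = 1}"

definition vol_one_radius :: "nat \<Rightarrow> real" where
  "vol_one_radius d = (THE r. 0 < r \<and> measure (R_space d) (R_cball d r) = 1)"

definition cap :: "nat \<Rightarrow> (nat \<Rightarrow> real) set \<Rightarrow> real \<Rightarrow> (nat \<Rightarrow> real) \<Rightarrow> (nat \<Rightarrow> real) set" where
  "cap d B t u = {x \<in> B. R_inner d x u \<ge> t}"

text \<open>
  The opposite vector \<open>-u\<close> has to be restricted to \<open>{..<d}\<close> to be a point of the space again.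
  By rotation invariance the volume does not depend on the unit vector \<open>u\<close>. Instead of
  singling out one of them, the infimum ranges over all of them.
\<close>

definition two_caps_vol :: "real \<Rightarrow> nat \<Rightarrow> (nat \<Rightarrow> real) \<Rightarrow> real" where
  "two_caps_vol c d u =
     (let r = vol_one_radius d; B = R_cball d r; t = c * r / sqrt (real d)
      in measure (R_space d) (cap d B t u \<union> cap d B t (\<lambda>i\<in>{..<d}. - u i)))"

definition gamma_caps :: "real \<Rightarrow> real" where
  "gamma_caps c = Inf {two_caps_vol c d u | d u. d \<ge> 2 \<and> u \<in> R_sphere d}"

text \<open>
  The real-valued \<open>diameter\<close> of the library is unspecified for unbounded sets, which are allowed
  here (convex sets need not be bounded, and the empty family has intersection \<open>UNIV\<close>). The
  following is the supremum of distances with values in \<open>[0, \<infinity>]\<close>. The empty set has diameter 0.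
\<close>

definition ediameter :: "'a :: metric_space set \<Rightarrow> ennreal" where
  "ediameter S = (SUP (x, y)\<in>S \<times> S. ennreal (dist x y))"

lemma ediameter_eq_diameter:
  assumes "bounded S"
  shows "ediameter S = ennreal (diameter S)"
proof (cases "S = {}")
  case True
  then show ?thesis by (simp add: ediameter_def bot_ennreal)
next
  case False
  show ?thesis
  proof (rule antisym)
    show "ediameter S \<le> ennreal (diameter S)"
      unfolding ediameter_def using assms
      by (auto intro!: SUP_least ennreal_leI diameter_bounded_bound)
    show "ennreal (diameter S) \<le> ediameter S"
    proof (cases "ediameter S = top")
      case fin: False
      then obtain m where m: "ediameter S = ennreal m" "0 \<le> m"
        by (metis ennreal_cases)
      have "dist x y \<le> m" if "x \<in> S" "y \<in> S" for x y
      proof -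
        have "ennreal (dist x y) \<le> ediameter S"
          unfolding ediameter_def using that by (intro SUP_upper2[of "(x, y)"]) auto
        then show ?thesis using m by simp
      qed
      then have "diameter S \<le> m"
        using False by (auto simp: diameter_def intro!: cSUP_least)
      then show ?thesis using m by (simp add: ennreal_leI)
    qed auto
  qed
qed

lemma measure_R_cball:
  assumes "r > 0"
  shows "measure (R_space d) (R_cball d r) = unit_ball_vol (real d) * r ^ d"
proof -
  have "R_cball d r =
      {f. sqrt (\<Sum>i\<in>{..<d}. (f i)\<^sup>2) \<le> r} \<inter> space (Pi\<^sub>M {..<d} (\<lambda>_. lborel))"
    by (auto simp: R_cball_def R_norm_def R_inner_def R_space_def power2_eq_square)
  then have "emeasure (R_space d) (R_cball d r) = ennreal (unit_ball_vol (real d) * r ^ d)"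
    using emeasure_cball_aux[of "{..<d}" r] assms by (simp add: R_space_def)
  then show ?thesis
    using assms by (simp add: measure_def)
qed

lemma vol_one_radius_eq:
  assumes "d > 0"
  shows "vol_one_radius d = root d (1 / unit_ball_vol (real d))"
  unfolding vol_one_radius_def
proof (rule the_equality)
  have pos: "unit_ball_vol (real d) > 0"
    by simp
  show "0 < root d (1 / unit_ball_vol (real d)) \<and>
      measure (R_space d) (R_cball d (root d (1 / unit_ball_vol (real d)))) = 1"
    using pos assms by (simp add: measure_R_cball less_imp_neq[OF pos, symmetric])
  show "r = root d (1 / unit_ball_vol (real d))"
    if "0 < r \<and> measure (R_space d) (R_cball d r) = 1" for r
  proof -
    have "unit_ball_vol (real d) * r ^ d = 1"
      using that measure_R_cball[of r d] by simp
    then have "r ^ d = 1 / unit_ball_vol (real d)"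
      using less_imp_neq[OF pos, symmetric] by (simp add: eq_divide_eq mult.commute)
    then show ?thesis
      using that assms by (metis less_imp_le real_root_power_cancel)
  qed
qed

end

theory Submission
  imports Defs
begin

text \<open>
The proof trades the diameter, which is not governed by a convex condition, for the extent in one
fixed direction, which is.

Every good tuple contains a segment of length (almost) one, in some direction \<open>v\<close>. For a uniformly
random point \<open>x\<close> of the ball of volume one and radius \<open>r\<close>, the probability of
\<open>\<bar>x \<bullet> v\<bar> \<ge> c r / \<surd>d\<close> is the volume of two opposite caps, hence at least \<open>\<gamma>(c)\<close>. Averaging over \<open>x\<close>
yields a single vector \<open>u = x / r\<close> of norm at most one such that a fraction of at least \<open>\<alpha> \<gamma>(c)\<close> of
all tuples contain a segment whose component along \<open>u\<close> is (almost) \<open>c / \<surd>d\<close>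
(\<open>ex_direction_many_components\<close>).

For fixed \<open>u\<close> and \<open>s > 0\<close>, a convex set \<open>A\<close> contains a segment with component \<open>s\<close> along \<open>u\<close> iff
\<open>A \<times> A\<close> meets the hyperplane \<open>{(x, y). u \<bullet> (y - x) = s}\<close> of \<open>\<real>\<^sup>2\<^sup>d\<close>, and
\<open>\<Inter>A\<in>\<G>. A \<times> A = \<Inter>\<G> \<times> \<Inter>\<G>\<close>. This hyperplane has dimension \<open>2d - 1\<close>, so Helly theorems in it concern
\<open>2d\<close>-tuples. The colourful fractional Helly theorem (\<open>colourful_fractional_helly\<close>) then gives a
subfamily of some \<open>F k\<close> of the asserted size whose intersection contains two points with
\<open>u \<bullet> (y - x) = s\<close>; as \<open>u\<close> has norm at most one, their distance is at least \<open>s\<close>.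

The colourful fractional Helly theorem is a counting argument. If, with \<open>m\<close> colours, no subfamily of
\<open>F k\<close> of relative size \<open>1 - m b\<close> intersects, then by Helly's theorem one can pull more than
\<open>b |F k|\<close> disjoint nonintersecting subfamilies of size at most \<open>m\<close> out of \<open>F k\<close>. For each choice of
one of them for every \<open>k\<close>, the colourful Helly theorem gives a nonintersecting transversal, and these
transversals are distinct. So more than a fraction \<open>b\<^sup>m\<close> of all tuples do not intersect.

Intersections need not be closed, so a diameter need not be attained. This is repaired by observing
that there are only finitely many candidate subfamilies: if all of them had diameter less than
\<open>c / \<surd>d\<close>, then they would all have diameter less than some \<open>s < c / \<surd>d\<close>.
\<close>

section \<open>Helly theorems inside an affine subspace\<close>

text \<open>
Ambient dimension is replaced by that of \<open>H\<close>: omitting one set at a time gives more than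
\<open>aff_dim H + 1\<close> points of \<open>H\<close>, which are therefore affinely dependent, and a Radon point of
them lies in all sets. If two of the chosen points coincide, that point already does.
\<close>

lemma helly_affine:
  fixes A :: "'i \<Rightarrow> 'a::euclidean_space set"
  assumes "finite J" and H: "affine H" "aff_dim H + 2 \<le> int (card J)"
    and conv: "\<And>j. j \<in> J \<Longrightarrow> convex (A j)"
    and meet: "\<And>j. j \<in> J \<Longrightarrow> H \<inter> (\<Inter>i\<in>J - {j}. A i) \<noteq> {}"
  shows "H \<inter> (\<Inter>i\<in>J. A i) \<noteq> {}"
proof -
  have "\<forall>j\<in>J. \<exists>x. x \<in> H \<inter> (\<Inter>i\<in>J - {j}. A i)"
    using meet by blast
  then obtain p where p: "\<And>j. j \<in> J \<Longrightarrow> p j \<in> H \<inter> (\<Inter>i\<in>J - {j}. A i)"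
    by metis
  show ?thesis
  proof (cases "inj_on p J")
    case False
    then obtain i j where "i \<in> J" "j \<in> J" "i \<noteq> j" "p i = p j"
      by (auto simp: inj_on_def)
    then have "p i \<in> H \<inter> (\<Inter>i\<in>J. A i)"
      using p[of i] p[of j] by (metis (no_types, lifting) DiffI INT_iff IntE IntI singletonD)
    then show ?thesis by blast
  next
    case True
    have "p ` J \<subseteq> H"
      using p by blast
    then have "aff_dim (p ` J) \<noteq> int (card (p ` J)) - 1"
      using aff_dim_subset[of "p ` J" H] H(2) by (simp add: card_image[OF True])
    then have "affine_dependent (p ` J)"
      using affine_independent_iff_card by blast
    then obtain M P where MP: "M \<subseteq> p ` J" "P \<subseteq> p ` J" "M \<inter> P = {}"
      "convex hull M \<inter> convex hull P \<noteq> {}"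
      by (rule Radon)
    then obtain z where z: "z \<in> convex hull M" "z \<in> convex hull P"
      by blast
    have hull: "z \<in> A i" if "i \<in> J" "p i \<notin> Q" "Q \<subseteq> p ` J" "z \<in> convex hull Q" for i Q
    proof -
      have "Q \<subseteq> A i"
        using that p by (fastforce dest: subsetD)
      then show ?thesis
        using hull_minimal[of Q "A i" convex] conv[OF that(1)] that(4) by blast
    qed
    have "convex hull M \<subseteq> H"
      using MP(1) \<open>p ` J \<subseteq> H\<close> H(1) by (intro hull_minimal affine_imp_convex) auto
    moreover have "z \<in> A i" if "i \<in> J" for i
      using hull[of i M] hull[of i P] MP z that by blast
    ultimately show ?thesis
      using z by blast
  qed
qed

text \<open>
For a tuple \<open>X\<close> and a colour \<open>i\<close>, take the point of least norm in the intersection of the sets of \<open>X\<close>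
with colour \<open>i\<close> left out, and choose \<open>(i, X)\<close> such that this norm is largest. The resulting point lies
in every set of colour \<open>i\<close>: a set missing it could be swapped into \<open>X\<close>, which would raise the least
norm over the complete tuple, and by Helly's theorem that least norm is already forced by all but one
of the sets, contrary to the choice of \<open>(i, X)\<close>.
\<close>

lemma colourful_helly_closed:
  fixes S :: "'i \<Rightarrow> 'a::euclidean_space set"
  assumes I: "finite I" "I \<noteq> {}" and C: "\<And>k. k \<in> I \<Longrightarrow> finite (C k)"
    and H: "affine H" "H \<noteq> {}" "aff_dim H < int (card I)"
    and S: "\<And>j. convex (S j)" "\<And>j. closed (S j)"
    and meet: "\<And>X. X \<in> Pi\<^sub>E I C \<Longrightarrow> H \<inter> (\<Inter>k\<in>I. S (X k)) \<noteq> {}"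
  shows "\<exists>k\<in>I. H \<inter> (\<Inter>j\<in>C k. S j) \<noteq> {}"
proof (cases "Pi\<^sub>E I C = {}")
  case True
  then obtain k where "k \<in> I" "C k = {}"
    by (auto simp: PiE_eq_empty_iff)
  then show ?thesis using H(2) by (intro bexI[of _ k]) auto
next
  case False
  define P where "P i X = H \<inter> (\<Inter>k\<in>I - {i}. S (X k))" for i X
  define m where "m i X = closest_point (P i X) 0" for i X
  have closedP: "closed (P i X)" and convexP: "convex (P i X)" for i X
    unfolding P_def using H(1) S
    by (auto intro!: closed_Int closed_INT convex_Int convex_INT simp: affine_closed affine_imp_convex)
  have neP: "P i X \<noteq> {}" if "X \<in> Pi\<^sub>E I C" for i X
    using meet[OF that] unfolding P_def by blast
  have mP: "m i X \<in> P i X" and m_le: "\<And>y. y \<in> P i X \<Longrightarrow> norm (m i X) \<le> norm y"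
    if "X \<in> Pi\<^sub>E I C" for i X
    using closest_point_exists[OF closedP neP[OF that], of i 0] unfolding m_def by auto
  define f where "f = (\<lambda>(i, X). norm (m i X))"
  have finite: "finite (I \<times> Pi\<^sub>E I C)"
    using I C by (intro finite_cartesian_product finite_PiE) auto
  have "I \<times> Pi\<^sub>E I C \<noteq> {}"
    using I(2) False by blast
  then obtain z where z: "z \<in> I \<times> Pi\<^sub>E I C" "Max (f ` (I \<times> Pi\<^sub>E I C)) = f z"
    by (rule obtains_MAX[OF finite])
  obtain i X where "z = (i, X)"
    by (cases z)
  then have i: "i \<in> I" and X: "X \<in> Pi\<^sub>E I C"
    using z by auto
  have max: "norm (m i' X') \<le> norm (m i X)" if "i' \<in> I" "X' \<in> Pi\<^sub>E I C" for i' X'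
  proof -
    have "f (i', X') \<le> f z"
      unfolding z(2)[symmetric] using that finite by (intro Max_ge) auto
    then show ?thesis
      by (simp add: f_def \<open>z = (i, X)\<close>)
  qed
  have "m i X \<in> S j" if j: "j \<in> C i" for j
  proof (rule ccontr)
    assume notin: "m i X \<notin> S j"
    define Y where "Y = X(i := j)"
    have Y: "Y \<in> Pi\<^sub>E I C"
      using X i j unfolding Y_def by (auto simp: PiE_iff extensional_def)
    have PY: "P i Y = P i X"
      unfolding P_def Y_def by auto
    define K where "K = H \<inter> (\<Inter>k\<in>I. S (Y k))"
    have K: "closed K" "K \<noteq> {}"
      using meet[OF Y] H(1) S unfolding K_def by (auto intro!: closed_Int closed_INT simp: affine_closed)
    define q where "q = closest_point K 0"
    have q: "q \<in> K" and q_le: "\<And>y. y \<in> K \<Longrightarrow> norm q \<le> norm y"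
      using closest_point_exists[OF K, of 0] unfolding q_def by auto
    have "q \<in> P i Y"
      using q unfolding K_def P_def by auto
    then have "q \<in> P i X"
      by (simp only: PY)
    have "q \<in> S (Y i)"
      using q i unfolding K_def by blast
    then have "q \<in> S j"
      by (simp add: Y_def)
    have "norm (m i X) < norm q"
    proof (rule ccontr)
      assume "\<not> norm (m i X) < norm q"
      then have "dist 0 q \<le> dist 0 y" if "y \<in> P i X" for y
        using m_le[OF X that] by simp
      then have "q = m i X"
        unfolding m_def by (intro closest_point_unique[OF convexP closedP \<open>q \<in> P i X\<close>] ballI)
      then show False using notin \<open>q \<in> S j\<close> by simp
    qed
    \<comment> \<open>Adding the open ball of radius \<open>norm q\<close> to the sets of
        \<open>Y\<close> makes the intersection empty.\<close>
    define A where "A = case_option (ball 0 (norm q)) (\<lambda>k. S (Y k))"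
    have "\<exists>j\<in>insert None (Some ` I). H \<inter> (\<Inter>i\<in>insert None (Some ` I) - {j}. A i) = {}"
    proof (rule ccontr)
      assume *: "\<not> ?thesis"
      have "H \<inter> (\<Inter>i\<in>insert None (Some ` I). A i) \<noteq> {}"
      proof (rule helly_affine[OF _ H(1)])
        show "aff_dim H + 2 \<le> int (card (insert None (Some ` I)))"
          using H(3) I(1) by (simp add: card_image)
        show "convex (A j)" for j
          using S(1) by (cases j) (auto simp: A_def)
      qed (use * I in auto)
      then show False
        using q_le unfolding K_def A_def by fastforce
    qed
    then obtain j' where j': "j' \<in> insert None (Some ` I)"
      "H \<inter> (\<Inter>i\<in>insert None (Some ` I) - {j'}. A i) = {}"
      by blast
    \<comment> \<open>Without the ball, \<open>q\<close> is a common point; so a set of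
        \<open>Y\<close> is the one that can be dropped.\<close>
    have "j' \<noteq> None"
      using j' q unfolding K_def A_def by auto
    then obtain i' where i': "i' \<in> I" "j' = Some i'"
      using j' by blast
    have "P i' Y \<inter> ball 0 (norm q) \<subseteq> H \<inter> (\<Inter>i\<in>insert None (Some ` I) - {j'}. A i)"
      unfolding P_def A_def i' by auto
    then have "norm q \<le> norm (m i' Y)"
      using mP[OF Y, of i'] j'(2) by (fastforce simp: not_less[symmetric])
    then show False
      using \<open>norm (m i X) < norm q\<close> max[OF i'(1) Y] by linarith
  qed
  then have "m i X \<in> H \<inter> (\<Inter>j\<in>C i. S j)"
    using mP[OF X, of i] unfolding P_def by blast
  then show ?thesis using i by blast
qed

text \<open>
Each set is shrunk to the convex hull of one witness from every transversal that it takes part in.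
The transversals still meet, and the hulls of finitely many points are closed.
\<close>

lemma colourful_helly:
  fixes S :: "'i \<Rightarrow> 'a::euclidean_space set"
  assumes I: "finite I" "I \<noteq> {}" and C: "\<And>k. k \<in> I \<Longrightarrow> finite (C k)"
    and H: "affine H" "H \<noteq> {}" "aff_dim H < int (card I)"
    and S: "\<And>k j. k \<in> I \<Longrightarrow> j \<in> C k \<Longrightarrow> convex (S j)"
    and meet: "\<And>X. X \<in> Pi\<^sub>E I C \<Longrightarrow> H \<inter> (\<Inter>k\<in>I. S (X k)) \<noteq> {}"
  shows "\<exists>k\<in>I. H \<inter> (\<Inter>j\<in>C k. S j) \<noteq> {}"
proof -
  have "\<forall>X\<in>Pi\<^sub>E I C. \<exists>x. x \<in> H \<inter> (\<Inter>k\<in>I. S (X k))"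
    using meet by blast
  then obtain w where w: "\<And>X. X \<in> Pi\<^sub>E I C \<Longrightarrow> w X \<in> H \<inter> (\<Inter>k\<in>I. S (X k))"
    by metis
  define S' where "S' j = convex hull (w ` {X \<in> Pi\<^sub>E I C. j \<in> X ` I})" for j
  have "finite (Pi\<^sub>E I C)"
    using I C by (intro finite_PiE) auto
  then have closed: "closed (S' j)" for j
    unfolding S'_def by (intro compact_imp_closed finite_imp_compact_convex_hull) simp
  have sub: "S' j \<subseteq> S j" if "k \<in> I" "j \<in> C k" for k j
    unfolding S'_def using w S[OF that] by (intro hull_minimal) auto
  have "\<exists>k\<in>I. H \<inter> (\<Inter>j\<in>C k. S' j) \<noteq> {}"
  proof (rule colourful_helly_closed[OF I C H _ closed])
    show "convex (S' j)" for j
      by (simp add: S'_def)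
    show "H \<inter> (\<Inter>k\<in>I. S' (X k)) \<noteq> {}" if "X \<in> Pi\<^sub>E I C" for X
    proof -
      have "w X \<in> S' (X k)" if "k \<in> I" for k
        unfolding S'_def using \<open>X \<in> _\<close> that by (intro hull_inc) auto
      then show ?thesis using w[OF that] by blast
    qed
  qed
  then show ?thesis using sub by blast
qed

text \<open>
Count nonintersecting transversals. With \<open>m\<close> colours and \<open>b = (1 - a)\<^sup>1\<^sup>/\<^sup>m\<close>, failure of the claim
leaves more than \<open>b |F k|\<close> disjoint nonintersecting subfamilies of size at most \<open>m\<close> in each \<open>F k\<close>, and
each choice of one of them per colour contains a nonintersecting transversal. These are more than
\<open>b\<^sup>m = 1 - a\<close> of all transversals.
\<close>

lemma colourful_fractional_helly:
  fixes S :: "'i \<Rightarrow> 'a::euclidean_space set" and a :: real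
  assumes I: "finite I" "I \<noteq> {}" and F: "\<And>k. k \<in> I \<Longrightarrow> finite (F k)"
    and H: "affine H" "H \<noteq> {}" "aff_dim H < int (card I)"
    and S: "\<And>k j. k \<in> I \<Longrightarrow> j \<in> F k \<Longrightarrow> convex (S j)"
    and a: "a \<le> 1"
    and many: "a * real (card (Pi\<^sub>E I F)) \<le> real (card {X \<in> Pi\<^sub>E I F. H \<inter> (\<Inter>k\<in>I. S (X k)) \<noteq> {}})"
  shows "\<exists>k\<in>I. \<exists>G\<subseteq>F k. H \<inter> (\<Inter>j\<in>G. S j) \<noteq> {} \<and>
    (1 - real (card I) * (1 - a) powr (1 / real (card I))) * real (card (F k)) \<le> real (card G)"
proof (rule ccontr)
  assume contra: "\<not> ?thesis"
  define m where "m = card I"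
  define b where "b = (1 - a) powr (1 / real m)"
  define meets where "meets G \<longleftrightarrow> H \<inter> (\<Inter>j\<in>G. S j) \<noteq> {}" for G
  have m: "0 < m"
    using I by (simp add: m_def card_gt_0_iff)
  have "0 \<le> b"
    by (simp add: b_def)
  have b_pow: "b ^ m = 1 - a"
    using a m by (cases "a = 1") (auto simp: b_def powr_powr simp flip: powr_realpow)
  have large: "\<not> meets G"
    if "k \<in> I" "G \<subseteq> F k" "(1 - real m * b) * real (card (F k)) \<le> real (card G)" for k G
    using contra that unfolding meets_def m_def b_def by blast
  \<comment> \<open>This is Helly's theorem, as the colourful one with all colour classes equal to
      \<open>G\<close>.\<close>
  have small: "\<exists>T\<subseteq>G. card T \<le> m \<and> \<not> meets T"
    if k: "k \<in> I" and G: "G \<subseteq> F k" "\<not> meets G" for k G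
  proof -
    have "\<exists>X\<in>Pi\<^sub>E I (\<lambda>_. G). H \<inter> (\<Inter>k\<in>I. S (X k)) = {}"
    proof (rule ccontr)
      assume "\<not> ?thesis"
      then have "\<exists>k\<in>I. H \<inter> (\<Inter>j\<in>G. S j) \<noteq> {}"
        using S k G F[OF k] by (intro colourful_helly[OF I _ H]) (auto intro: finite_subset)
      then show False using G unfolding meets_def by blast
    qed
    then obtain X where X: "X \<in> Pi\<^sub>E I (\<lambda>_. G)" "H \<inter> (\<Inter>k\<in>I. S (X k)) = {}"
      by blast
    then show ?thesis
      using card_image_le[OF I(1), of X]
      by (intro exI[of _ "X ` I"]) (auto simp: meets_def m_def)
  qed
  \<comment> \<open>As long as at most \<open>b |F k|\<close> subfamilies have been removed, what
      remains is too large to intersect, so a further one can be found.\<close>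
  have disj: "\<exists>\<T>. \<T> \<subseteq> Pow (F k) \<and> card \<T> = t \<and> finite \<T> \<and> pairwise disjnt \<T> \<and>
      (\<forall>T\<in>\<T>. card T \<le> m \<and> \<not> meets T)"
    if k: "k \<in> I" and "t = 0 \<or> real (t - 1) \<le> b * real (card (F k))" for k t
    using that(2)
  proof (induction t)
    case 0
    show ?case by (intro exI[of _ "{}"]) auto
  next
    case (Suc t)
    then have t: "real t \<le> b * real (card (F k))"
      by simp
    then have "t = 0 \<or> real (t - 1) \<le> b * real (card (F k))"
      by (cases t) auto
    from Suc.IH[OF this]
    obtain \<T> where \<T>: "\<T> \<subseteq> Pow (F k)" "card \<T> = t" "finite \<T>" "pairwise disjnt \<T>"
      "\<forall>T\<in>\<T>. card T \<le> m \<and> \<not> meets T"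
      by (elim exE conjE)
    define R where "R = F k - \<Union>\<T>"
    have "card (\<Union>\<T>) \<le> t * m"
      using card_Union_le_sum_card[of \<T>] sum_bounded_above[of \<T> card m] \<T> by force
    moreover have "card R = card (F k) - card (\<Union>\<T>)" "card (\<Union>\<T>) \<le> card (F k)"
      using \<T> F[OF k] unfolding R_def by (auto intro!: card_Diff_subset card_mono intro: finite_subset)
    ultimately have "real (card (F k)) - real t * real m \<le> real (card R)"
      by (simp add: of_nat_diff flip: of_nat_mult)
    moreover have "real t * real m \<le> (b * real (card (F k))) * real m"
      using t by (intro mult_right_mono) auto
    ultimately have "(1 - real m * b) * real (card (F k)) \<le> real (card R)"
      by (simp add: algebra_simps)
    then have "\<not> meets R"
      using k by (intro large) (auto simp: R_def)
    then obtain T where T: "T \<subseteq> R" "card T \<le> m" "\<not> meets T"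
      using small[OF k, of R] unfolding R_def by blast
    have "T \<noteq> {}"
      using T H(2) by (auto simp: meets_def)
    then have "T \<notin> \<T>"
      using T(1) unfolding R_def by blast
    moreover have "pairwise disjnt (insert T \<T>)"
      using \<T>(4) T(1) unfolding R_def by (auto simp: pairwise_insert disjnt_def)
    ultimately show ?case
      using \<T> T by (intro exI[of _ "insert T \<T>"]) (auto simp: R_def)
  qed
  have "\<exists>\<T>. \<T> \<subseteq> Pow (F k) \<and> b * real (card (F k)) < real (card \<T>) \<and> pairwise disjnt \<T> \<and>
      (\<forall>T\<in>\<T>. \<not> meets T)"
    if k: "k \<in> I" for k
  proof -
    define t where "t = nat \<lfloor>b * real (card (F k))\<rfloor>"
    have "0 \<le> b * real (card (F k))"
      using \<open>0 \<le> b\<close> by simp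
    then have t: "real t \<le> b * real (card (F k))" "b * real (card (F k)) < real (Suc t)"
      unfolding t_def by linarith+
    then have "Suc t = 0 \<or> real (Suc t - 1) \<le> b * real (card (F k))"
      by simp
    from disj[OF k this] obtain \<T> where "\<T> \<subseteq> Pow (F k)" "card \<T> = Suc t" "pairwise disjnt \<T>"
      "\<forall>T\<in>\<T>. card T \<le> m \<and> \<not> meets T"
      by (elim exE conjE)
    then show ?thesis
      using t(2) by (intro exI[of _ \<T>]) auto
  qed
  then obtain \<T> where \<T>: "\<And>k. k \<in> I \<Longrightarrow> \<T> k \<subseteq> Pow (F k)"
    "\<And>k. k \<in> I \<Longrightarrow> b * real (card (F k)) < real (card (\<T> k))"
    "\<And>k. k \<in> I \<Longrightarrow> pairwise disjnt (\<T> k)"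
    "\<And>k T. k \<in> I \<Longrightarrow> T \<in> \<T> k \<Longrightarrow> \<not> meets T"
    by metis
  have "\<exists>X\<in>Pi\<^sub>E I T. \<not> meets (X ` I)" if T: "T \<in> Pi\<^sub>E I \<T>" for T
  proof (rule ccontr)
    assume no_transversal: "\<not> ?thesis"
    have sub: "T k \<subseteq> F k" if "k \<in> I" for k
      using \<T>(1)[OF that] T that by auto
    have "\<exists>k\<in>I. H \<inter> (\<Inter>j\<in>T k. S j) \<noteq> {}"
    proof (rule colourful_helly[OF I _ H])
      show "finite (T k)" if "k \<in> I" for k
        using finite_subset[OF sub F] that by blast
      show "convex (S j)" if "k \<in> I" "j \<in> T k" for k j
        using S sub that by blast
    qed (use no_transversal in \<open>auto simp: meets_def\<close>)
    then show False using \<T>(4) T unfolding meets_def by blast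
  qed
  then obtain g where g: "\<And>T. T \<in> Pi\<^sub>E I \<T> \<Longrightarrow> g T \<in> Pi\<^sub>E I T \<and> \<not> meets (g T ` I)"
    by metis
  let ?N = "{X \<in> Pi\<^sub>E I F. \<not> meets (X ` I)}" and ?M = "{X \<in> Pi\<^sub>E I F. meets (X ` I)}"
  have fin: "finite (Pi\<^sub>E I F)"
    using I F by (intro finite_PiE) auto
  \<comment> \<open>A member of the transversal determines the subfamily that it comes from, by
      disjointness.\<close>
  have inj: "inj_on g (Pi\<^sub>E I \<T>)"
  proof (rule inj_onI)
    fix T U assume TU: "T \<in> Pi\<^sub>E I \<T>" "U \<in> Pi\<^sub>E I \<T>" "g T = g U"
    show "T = U"
    proof (rule PiE_ext[OF TU(1,2)])
      fix k assume k: "k \<in> I"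
      then have "g T k \<in> T k" "g T k \<in> U k"
        using g[OF TU(1)] g[OF TU(2)] TU(3) by auto
      moreover have "T k \<in> \<T> k" "U k \<in> \<T> k"
        using TU k by auto
      ultimately show "T k = U k"
        using \<T>(3)[OF k] by (auto simp: pairwise_def disjnt_def)
    qed
  qed
  have "g T \<in> ?N" if T: "T \<in> Pi\<^sub>E I \<T>" for T
  proof -
    have "T k \<subseteq> F k" if "k \<in> I" for k
      using \<T>(1)[OF that] T that by auto
    then show ?thesis using g[OF T] PiE_mono[of I T F] by blast
  qed
  then have "card (Pi\<^sub>E I \<T>) \<le> card ?N"
    using fin by (intro card_inj_on_le[OF inj]) auto
  moreover have "(1 - a) * real (card (Pi\<^sub>E I F)) < real (card (Pi\<^sub>E I \<T>))"
  proof -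
    have "(1 - a) * real (card (Pi\<^sub>E I F)) = (\<Prod>k\<in>I. b * real (card (F k)))"
      using I by (simp add: card_PiE prod.distrib b_pow flip: m_def)
    also have "\<dots> < (\<Prod>k\<in>I. real (card (\<T> k)))"
    proof -
      have le: "0 \<le> b * real (card (F k)) \<and> b * real (card (F k)) < real (card (\<T> k))" if "k \<in> I" for k
        using \<T>(2)[OF that] \<open>0 \<le> b\<close> by simp
      obtain k where "k \<in> I"
        using I(2) by blast
      then show ?thesis
      proof (rule prod_mono_strict[where i = k])
        show "0 \<le> b * real (card (F i)) \<and> b * real (card (F i)) \<le> real (card (\<T> i))" if "i \<in> I" for i
          using le[OF that] by linarith
        show "0 < real (card (\<T> i))" if "i \<in> I" for i
          using le[OF that] by linarith
        show "b * real (card (F k)) < real (card (\<T> k))"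
          using le[OF \<open>k \<in> I\<close>] by blast
      qed (rule I(1))
    qed
    finally show ?thesis
      using I by (simp add: card_PiE)
  qed
  moreover have "card ?N + card ?M = card (Pi\<^sub>E I F)"
  proof -
    have "?N \<union> ?M = Pi\<^sub>E I F" "?N \<inter> ?M = {}"
      by blast+
    then show ?thesis
      using card_Un_disjoint[of ?N ?M] fin by simp
  qed
  moreover have "a * real (card (Pi\<^sub>E I F)) \<le> real (card ?M)"
    using many by (simp add: meets_def)
  ultimately show False
    by (simp add: algebra_simps flip: of_nat_add)
qed

section \<open>A direction common to many unit vectors\<close>

lemma two_caps_vol_ge_gamma_caps:
  assumes "d \<ge> 2" "u \<in> R_sphere d"
  shows "gamma_caps c \<le> two_caps_vol c d u"
  unfolding gamma_caps_def
proof (rule cInf_lower)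
  show "bdd_below {two_caps_vol c d u | d u. d \<ge> 2 \<and> u \<in> R_sphere d}"
    by (intro bdd_belowI[of _ 0]) (auto simp: two_caps_vol_def Let_def)
qed (use assms in blast)

lemma vol_one_radius:
  assumes "d > 0"
  shows "vol_one_radius d > 0" "measure (R_space d) (R_cball d (vol_one_radius d)) = 1"
proof -
  have ball: "unit_ball_vol (real d) > 0"
    by simp
  then show pos: "vol_one_radius d > 0"
    using assms by (simp add: vol_one_radius_eq)
  show "measure (R_space d) (R_cball d (vol_one_radius d)) = 1"
    using assms pos less_imp_neq[OF ball, symmetric]
    by (simp add: measure_R_cball) (simp add: vol_one_radius_eq)
qed

lemma R_inner_measurable [measurable]: "(\<lambda>x. R_inner d x v) \<in> borel_measurable (R_space d)"
  unfolding R_inner_def R_space_def by measurable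

lemma R_cball_sets [measurable]: "R_cball d r \<in> sets (R_space d)"
  unfolding R_cball_def R_norm_def R_inner_def R_space_def by measurable

lemma two_caps_eq:
  "cap d B t u \<union> cap d B t (\<lambda>i\<in>{..<d}. - u i) = {x \<in> B. t \<le> \<bar>R_inner d x u\<bar>}"
  unfolding cap_def R_inner_def by (auto simp: sum_negf abs_real_def)

text \<open>
The integral over the ball \<open>B\<close> of volume one of the number \<open>n x\<close> of vectors \<open>v j\<close> with a large component
along \<open>x\<close> is the sum of the volumes of pairs of opposite caps. So the largest value of \<open>n\<close> is at least
\<open>\<gamma>(c)\<close> times the number of vectors.
\<close>

lemma ex_direction_many_components:
  assumes d: "d \<ge> 2" and J: "finite J" "\<And>j. j \<in> J \<Longrightarrow> v j \<in> R_sphere d"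
  shows "\<exists>x. R_norm d x \<le> 1 \<and>
    gamma_caps c * real (card J) \<le> real (card {j \<in> J. c / sqrt (real d) \<le> \<bar>R_inner d x (v j)\<bar>})"
proof -
  define r where "r = vol_one_radius d"
  define B where "B = R_cball d r"
  define t where "t = c * r / sqrt (real d)"
  define D where "D j = {x \<in> B. t \<le> \<bar>R_inner d x (v j)\<bar>}" for j
  define n where "n x = card {j \<in> J. x \<in> D j}" for x
  have r: "r > 0" "measure (R_space d) B = 1"
    using vol_one_radius[of d] d by (auto simp: r_def B_def)
  have B [measurable]: "B \<in> sets (R_space d)"
    by (simp add: B_def)
  have finB: "emeasure (R_space d) B < \<infinity>"
    using r(2) by (metis emeasure_eq_ennreal_measure ennreal_less_top infinity_ennreal_def measure_zero_top top.not_eq_extremum zero_neq_one)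
  have D [measurable]: "D j \<in> sets (R_space d)" for j
  proof -
    have "D j = B \<inter> {x \<in> space (R_space d). t \<le> \<bar>R_inner d x (v j)\<bar>}"
      using sets.sets_into_space[OF B] by (auto simp: D_def)
    then show ?thesis by simp
  qed
  have finD: "emeasure (R_space d) (D j) < \<infinity>" for j
    using emeasure_mono[of "D j" B "R_space d"] finB by (auto simp: D_def)
  have int: "integrable (R_space d) (\<lambda>x. indicator (D j) x :: real)" for j
    using finD by (simp add: integrable_indicator_iff)
  obtain x0 where x0: "x0 \<in> B" and max: "\<And>x. x \<in> B \<Longrightarrow> n x \<le> n x0"
  proof -
    have "B \<noteq> {}" using r(2) by auto
    moreover have "finite (n ` B)"
      by (rule finite_subset[of _ "{..card J}"]) (auto simp: n_def intro!: card_mono J)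
    ultimately obtain x where "x \<in> B" "n x = Max (n ` B)"
      using Max_in[of "n ` B"] by (metis (no_types, lifting) empty_is_image imageE)
    then show ?thesis
      using that[of x] \<open>finite (n ` B)\<close> by simp
  qed
  have "gamma_caps c * real (card J) \<le> (\<Sum>j\<in>J. measure (R_space d) (D j))"
  proof -
    have "gamma_caps c \<le> measure (R_space d) (D j)" if "j \<in> J" for j
      using two_caps_vol_ge_gamma_caps[OF d J(2)[OF that], of c]
      by (simp add: two_caps_vol_def Let_def two_caps_eq D_def B_def t_def r_def)
    then have "(\<Sum>j\<in>J. gamma_caps c) \<le> (\<Sum>j\<in>J. measure (R_space d) (D j))"
      by (intro sum_mono)
    then show ?thesis by (simp add: mult.commute)
  qed
  also have "\<dots> = (\<integral>x. (\<Sum>j\<in>J. indicator (D j) x) \<partial>R_space d)"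
    using int by (subst Bochner_Integration.integral_sum) auto
  also have "\<dots> \<le> (\<integral>x. real (n x0) * indicator B x \<partial>R_space d)"
  proof (rule integral_mono)
    show "integrable (R_space d) (\<lambda>x. \<Sum>j\<in>J. indicator (D j) x :: real)"
      using int by auto
    show "integrable (R_space d) (\<lambda>x. real (n x0) * indicator B x)"
      using finB by (intro integrable_mult_right) (simp add: integrable_indicator_iff)
    show "(\<Sum>j\<in>J. indicator (D j) x) \<le> real (n x0) * indicator B x" for x
    proof (cases "x \<in> B")
      case True
      have "(\<Sum>j\<in>J. indicator (D j) x) = real (n x)"
        unfolding n_def using J(1) by (simp add: sum.If_cases indicator_def Int_def)
      then show ?thesis using max[OF True] True by simp
    qed (auto simp: D_def)
  qed
  also have "\<dots> = real (n x0)"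
    using r(2) by simp
  finally have le: "gamma_caps c * real (card J) \<le> real (n x0)" .
  define x where "x i = x0 i / r" for i
  have inner: "R_inner d x w = R_inner d x0 w / r" for w
    by (simp add: R_inner_def x_def sum_divide_distrib)
  have "R_inner d x x = R_inner d x0 x0 / r\<^sup>2"
    by (simp add: R_inner_def x_def sum_divide_distrib power2_eq_square)
  then have "R_norm d x = R_norm d x0 / r"
    using r(1) by (simp add: R_norm_def real_sqrt_divide)
  then have "R_norm d x \<le> 1"
    using x0 r(1) by (simp add: B_def R_cball_def)
  moreover have "c / sqrt (real d) \<le> \<bar>R_inner d x (v j)\<bar>" if "x0 \<in> D j" for j
    using that r(1) by (simp add: D_def t_def inner field_simps)
  then have "n x0 \<le> card {j \<in> J. c / sqrt (real d) \<le> \<bar>R_inner d x (v j)\<bar>}"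
    unfolding n_def using J(1) by (intro card_mono) auto
  ultimately show ?thesis
    using le by (intro exI[of _ x]) auto
qed

text \<open>
The same in \<open>\<real>\<^sup>n\<close> as a type, by an enumeration of the coordinates. Only inner products are transferred,
no measures.
\<close>

lemma ex_direction_many_components_cart:
  fixes v :: "'j \<Rightarrow> real ^ 'n"
  assumes d: "CARD('n) \<ge> 2" and J: "finite J" "\<And>j. j \<in> J \<Longrightarrow> norm (v j) = 1"
  shows "\<exists>u :: real ^ 'n. norm u \<le> 1 \<and> gamma_caps c * real (card J) \<le>
    real (card {j \<in> J. c / sqrt (real CARD('n)) \<le> \<bar>u \<bullet> v j\<bar>})"
proof -
  obtain e :: "nat \<Rightarrow> 'n" where e: "bij_betw e {..<CARD('n)} UNIV"
    using ex_bij_betw_nat_finite[of "UNIV :: 'n set"] by (auto simp: atLeast0LessThan)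
  define g :: "real ^ 'n \<Rightarrow> nat \<Rightarrow> real" where "g w = (\<lambda>i\<in>{..<CARD('n)}. w $ e i)" for w
  have inner: "R_inner CARD('n) x (g w) = (\<chi> k. x (inv_into {..<CARD('n)} e k)) \<bullet> w" for x w
  proof -
    have "(\<chi> k. x (inv_into {..<CARD('n)} e k)) \<bullet> w = (\<Sum>i<CARD('n). x (inv_into {..<CARD('n)} e (e i)) * w $ e i)"
      unfolding inner_vec_def by (simp add: sum.reindex_bij_betw[OF e, symmetric])
    also have "\<dots> = R_inner CARD('n) x (g w)"
      unfolding R_inner_def g_def using bij_betw_inv_into_left[OF e] by (intro sum.cong) auto
    finally show ?thesis by simp
  qed
  have g_inv: "(\<chi> k. g w (inv_into {..<CARD('n)} e k)) = w" for w
    using bij_betw_inv_into_right[OF e] bij_betw_apply[OF bij_betw_inv_into[OF e]]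
    by (simp add: vec_eq_iff g_def)
  have sphere: "g (v j) \<in> R_sphere CARD('n)" if "j \<in> J" for j
  proof -
    have "R_norm CARD('n) (g (v j)) = 1"
      using J(2)[OF that] by (simp add: R_norm_def inner g_inv norm_eq_sqrt_inner)
    then show ?thesis
      by (simp add: R_sphere_def R_space_def space_PiM g_def)
  qed
  obtain x where x: "R_norm CARD('n) x \<le> 1" "gamma_caps c * real (card J) \<le>
    real (card {j \<in> J. c / sqrt (real CARD('n)) \<le> \<bar>R_inner CARD('n) x (g (v j))\<bar>})"
    using ex_direction_many_components[OF d J(1), where v = "\<lambda>j. g (v j)" and c = c] sphere by blast
  define u :: "real ^ 'n" where "u = (\<chi> k. x (inv_into {..<CARD('n)} e k))"
  have "R_inner CARD('n) x x = R_inner CARD('n) x (g u)"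
    unfolding R_inner_def using bij_betw_inv_into_left[OF e] by (intro sum.cong) (auto simp: g_def u_def)
  then have "norm u = R_norm CARD('n) x"
    by (simp add: R_norm_def norm_eq_sqrt_inner inner u_def)
  then show ?thesis
    using x by (intro exI[of _ u]) (simp add: inner u_def)
qed

section \<open>Segments with a prescribed component\<close>

lemma dist_le_ediameter: "x \<in> S \<Longrightarrow> y \<in> S \<Longrightarrow> ennreal (dist x y) \<le> ediameter S"
  unfolding ediameter_def by (rule SUP_upper2[of "(x, y)"]) auto

lemma less_ediameter_imp_dist:
  assumes "ennreal s < ediameter S"
  obtains x y where "x \<in> S" "y \<in> S" "s < dist x y"
proof -
  obtain x y where "x \<in> S" "y \<in> S" "ennreal s < ennreal (dist x y)"
    using assms unfolding ediameter_def less_SUP_iff by auto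
  then show thesis
    using that[of x y] ennreal_leI[of "dist x y" s] by (meson not_le)
qed

text \<open>
After orienting the segment along \<open>u\<close>, shortening it gives the component \<open>s\<close> exactly.
\<close>

lemma segment_with_component:
  fixes K :: "'a::real_inner set"
  assumes "convex K" "x \<in> K" "y \<in> K" "0 < s" "s \<le> \<bar>u \<bullet> (y - x)\<bar>"
  obtains x' y' where "x' \<in> K" "y' \<in> K" "u \<bullet> (y' - x') = s"
proof -
  have *: thesis if "x \<in> K" "y \<in> K" "s \<le> u \<bullet> (y - x)" for x y
  proof -
    define t where "t = s / (u \<bullet> (y - x))"
    have "0 \<le> t" "t \<le> 1" "t * (u \<bullet> (y - x)) = s"
      using that(3) assms(4) by (auto simp: t_def)
    moreover from this have "(1 - t) *\<^sub>R x + t *\<^sub>R y \<in> K"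
      using convexD_alt[OF assms(1) that(1,2)] by blast
    moreover have "(1 - t) *\<^sub>R x + t *\<^sub>R y - x = t *\<^sub>R (y - x)"
      by (simp add: algebra_simps)
    ultimately show thesis
      using \<open>\<And>x' y'. x' \<in> K \<Longrightarrow> y' \<in> K \<Longrightarrow> u \<bullet> (y' - x') = s \<Longrightarrow> thesis\<close>[OF that(1)] by simp
  qed
  show thesis
  proof (cases "0 \<le> u \<bullet> (y - x)")
    case True
    then show thesis using *[of x y] assms by simp
  next
    case False
    then have "s \<le> u \<bullet> (x - y)"
      using assms(5) by (simp add: inner_diff_right)
    then show thesis using *[of y x] assms by simp
  qed
qed

text \<open>
The sets \<open>A \<times> A\<close> are cut with a hyperplane \<open>H\<close> in the product space. It has dimension
\<open>2 * DIM('a) - 1\<close>, one less than the number of colours.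
\<close>

lemma colourful_fractional_helly_width:
  fixes F :: "'k \<Rightarrow> 'a::euclidean_space set set" and u :: 'a and a s :: real
  assumes I: "finite I" "card I = 2 * DIM('a)" and u: "u \<noteq> 0"
    and F: "\<And>k. k \<in> I \<Longrightarrow> finite (F k)" "\<And>k A. k \<in> I \<Longrightarrow> A \<in> F k \<Longrightarrow> convex A"
    and a: "a \<le> 1"
    and many: "a * real (card (Pi\<^sub>E I F)) \<le>
      real (card {X \<in> Pi\<^sub>E I F. \<exists>x\<in>(\<Inter>k\<in>I. X k). \<exists>y\<in>(\<Inter>k\<in>I. X k). u \<bullet> (y - x) = s})"
  shows "\<exists>k\<in>I. \<exists>G\<subseteq>F k. (\<exists>x\<in>\<Inter>G. \<exists>y\<in>\<Inter>G. u \<bullet> (y - x) = s) \<and>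
    (1 - real (card I) * (1 - a) powr (1 / real (card I))) * real (card (F k)) \<le> real (card G)"
proof -
  define H where "H = {z :: 'a \<times> 'a. (- u, u) \<bullet> z = s}"
  have mem_H: "(x, y) \<in> H \<longleftrightarrow> u \<bullet> (y - x) = s" for x y
    by (auto simp: H_def inner_diff_right)
  have meets: "H \<inter> (\<Inter>i\<in>K. A i \<times> A i) \<noteq> {} \<longleftrightarrow>
      (\<exists>x\<in>(\<Inter>i\<in>K. A i). \<exists>y\<in>(\<Inter>i\<in>K. A i). u \<bullet> (y - x) = s)"
    for K :: "'i set" and A :: "'i \<Rightarrow> 'a set"
    unfolding ex_in_conv[symmetric] split_paired_Ex Int_iff mem_H by blast
  have "affine H"
    unfolding H_def by (rule affine_hyperplane)
  moreover have "aff_dim H = int (2 * DIM('a)) - 1"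
  proof -
    have "(- u, u) \<noteq> 0"
      using u by (simp add: zero_prod_def)
    moreover have "0 < DIM('a)"
      by simp
    ultimately show ?thesis
      unfolding H_def by (subst aff_dim_hyperplane) (auto simp: of_nat_diff Suc_le_eq)
  qed
  moreover have "H \<noteq> {}"
    using calculation(2) by force
  ultimately have "\<exists>k\<in>I. \<exists>G\<subseteq>F k. H \<inter> (\<Inter>A\<in>G. A \<times> A) \<noteq> {} \<and>
    (1 - real (card I) * (1 - a) powr (1 / real (card I))) * real (card (F k)) \<le> real (card G)"
  proof (intro colourful_fractional_helly)
    show "a * real (card (Pi\<^sub>E I F)) \<le>
        real (card {X \<in> Pi\<^sub>E I F. H \<inter> (\<Inter>k\<in>I. X k \<times> X k) \<noteq> {}})"
      unfolding meets by (rule many)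
    show "convex (A \<times> A)" if "k \<in> I" "A \<in> F k" for k A
      using F(2)[OF that] by (simp add: convex_Times)
  qed (use F(1) a I in auto)
  then show ?thesis
    unfolding meets by simp
qed

theorem theorem1p3:
  fixes c \<alpha> \<beta> :: real and d N :: nat
    and F :: "nat \<Rightarrow> (real ^ 'n) set set"
  assumes d: "CARD('n) = d" "d \<ge> 2"
    and c: "0 < c" "c < sqrt 2"
    and \<alpha>: "0 < \<alpha>" "\<alpha> \<le> 1"
    and \<beta>: "\<beta> = 1 - 2 * real d * (1 - \<alpha> * gamma_caps c) powr (1 / (2 * real d))"
    and fin: "\<And>i. i \<in> {1..2*d} \<Longrightarrow> finite (F i)"
    and conv: "\<And>i A. i \<in> {1..2*d} \<Longrightarrow> A \<in> F i \<Longrightarrow> convex A"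
    and N: "N = (\<Prod>i\<in>{1..2*d}. card (F i))"
    and many: "real (card {X \<in> Pi\<^sub>E {1..2*d} F. ediameter (\<Inter>i\<in>{1..2*d}. X i) \<ge> 1}) \<ge> \<alpha> * real N"
  shows "\<exists>k\<in>{1..2*d}. \<exists>\<G>. \<G> \<subseteq> F k \<and> real (card \<G>) \<ge> \<beta> * real (card (F k)) \<and>
           ediameter (\<Inter>\<G>) \<ge> ennreal (c * real d powr (- (1 / 2)))"
proof (rule ccontr)
  assume contra: "\<not> ?thesis"
  define I where "I = {1..2*d}"
  note fin = fin[folded I_def] and conv = conv[folded I_def]
    and N = N[folded I_def] and many = many[folded I_def]
  define w where "w = c / sqrt (real d)"
  have w: "0 < w" "w = c * real d powr (- (1 / 2))"
    using c d by (auto simp: w_def powr_minus_divide powr_half_sqrt)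
  have small: "ediameter (\<Inter>G) < ennreal w"
    if "k \<in> I" "G \<subseteq> F k" "\<beta> * real (card (F k)) \<le> real (card G)" for k G
  proof (rule ccontr)
    assume "\<not> ediameter (\<Inter>G) < ennreal w"
    then have "ennreal (c * real d powr (- (1 / 2))) \<le> ediameter (\<Inter>G)"
      by (simp only: w(2) not_less)
    then show False
      using contra that unfolding I_def by blast
  qed
  \<comment> \<open>The empty subfamily has the whole space as intersection. So it settles the
      case in which \<open>\<beta> \<le> 0\<close> or some \<open>F k\<close> is empty.\<close>
  have big_empty: "\<not> ediameter (\<Inter>({} :: (real ^ 'n) set set)) < ennreal w"
  proof -
    have "ennreal w = ennreal (dist 0 (w *\<^sub>R (axis undefined 1 :: real ^ 'n)))"
      using w(1) by simp
    also have "\<dots> \<le> ediameter (\<Inter>({} :: (real ^ 'n) set set))"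
      by (rule dist_le_ediameter) auto
    finally show ?thesis by simp
  qed
  have pos: "0 < \<beta> * real (card (F k))" if "k \<in> I" for k
  proof (rule ccontr)
    assume "\<not> ?thesis"
    then have "\<beta> * real (card (F k)) \<le> real (card {})"
      by simp
    then show False
      using small[OF that empty_subsetI] big_empty by blast
  qed
  have I: "finite I" "1 \<in> I" "card I = 2 * d"
    using d by (auto simp: I_def)
  have "0 < \<beta>" and card_pos: "0 < card (F k)" if "k \<in> I" for k
    using pos[OF that] by (auto simp: zero_less_mult_iff)
  then have "0 < \<beta>"
    using I(2) by blast
  have N_pos: "0 < N" "N = card (Pi\<^sub>E I F)"
    using card_pos I N by (auto simp: card_PiE intro!: prod_pos)
  \<comment> \<open>A nonpositive product would make \<open>\<beta>\<close> negative.\<close>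
  have \<gamma>: "0 < \<alpha> * gamma_caps c"
  proof (rule ccontr)
    assume "\<not> ?thesis"
    then have "1 \<le> (1 - \<alpha> * gamma_caps c) powr (1 / (2 * real d))"
      by (intro ge_one_powr_ge_zero) auto
    then have "2 * 1 \<le> (2 * real d) * (1 - \<alpha> * gamma_caps c) powr (1 / (2 * real d))"
      using d(2) by (intro mult_mono) auto
    then show False
      using \<open>0 < \<beta>\<close> unfolding \<beta> by linarith
  qed
  \<comment> \<open>The diameters of all candidate subfamilies. The element 0 makes the set
      nonempty and the number \<open>s\<close> below positive.\<close>
  define \<E> where "\<E> = insert 0 {ediameter (\<Inter>G) | G. \<exists>k\<in>I. G \<subseteq> F k \<and> \<beta> * real (card (F k)) \<le> real (card G)}"
  have "finite \<E>"
  proof (rule finite_subset)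
    show "\<E> \<subseteq> insert 0 ((\<lambda>G. ediameter (\<Inter>G)) ` (\<Union>k\<in>I. Pow (F k)))"
      unfolding \<E>_def by blast
  qed (use I fin in auto)
  moreover have "\<forall>e\<in>\<E>. e < ennreal w"
    using small w(1) by (auto simp: \<E>_def)
  ultimately have "Max \<E> < ennreal w"
    by (subst Max_less_iff) (auto simp: \<E>_def)
  then obtain e where e: "Max \<E> < e" "e < ennreal w"
    using dense by blast
  define s where "s = enn2real e"
  have "e \<noteq> top"
    using e(2) by auto
  then have e_eq: "e = ennreal s"
    by (simp add: s_def less_top)
  have "0 < e"
    using e(1) by (metis gr_zeroI not_less_zero)
  then have s: "0 < s" "s < w"
    using e(2) w(1) by (auto simp: e_eq ennreal_less_iff)
  have small': "ediameter (\<Inter>G) < ennreal s"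
    if "k \<in> I" "G \<subseteq> F k" "\<beta> * real (card (F k)) \<le> real (card G)" for k G
  proof -
    have "ediameter (\<Inter>G) \<le> Max \<E>"
      using that \<open>finite \<E>\<close> by (intro Max_ge) (auto simp: \<E>_def)
    then show ?thesis using e(1) by (simp add: e_eq)
  qed
  have fin_tuples: "finite (Pi\<^sub>E I F)"
    using I(1) fin by (intro finite_PiE)
  define \<X> where "\<X> = {X \<in> Pi\<^sub>E I F. ediameter (\<Inter>i\<in>I. X i) \<ge> 1}"
  have \<X>: "finite \<X>" "\<alpha> * real N \<le> real (card \<X>)"
    using many fin_tuples by (auto simp: \<X>_def)
  \<comment> \<open>Points at distance more than \<open>s / w\<close> suffice: for the tuples selected
      by \<open>u\<close> below, at least a fraction \<open>w\<close> of the distance remains along \<open>u\<close>.\<close>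
  have "\<exists>p. fst p \<in> (\<Inter>i\<in>I. X i) \<and> snd p \<in> (\<Inter>i\<in>I. X i) \<and> s / w < dist (fst p) (snd p)" if "X \<in> \<X>" for X
  proof -
    have "ennreal (s / w) < 1"
      using s w(1) by (simp add: ennreal_less_one_iff)
    also have "1 \<le> ediameter (\<Inter>i\<in>I. X i)"
      using that unfolding \<X>_def by blast
    finally have "ennreal (s / w) < ediameter (\<Inter>i\<in>I. X i)" .
    then obtain x y where "x \<in> (\<Inter>i\<in>I. X i)" "y \<in> (\<Inter>i\<in>I. X i)" "s / w < dist x y"
      by (rule less_ediameter_imp_dist)
    then show ?thesis
      by (intro exI[of _ "(x, y)"]) simp
  qed
  then obtain p where p: "\<And>X. X \<in> \<X> \<Longrightarrow> fst (p X) \<in> (\<Inter>i\<in>I. X i)"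
    "\<And>X. X \<in> \<X> \<Longrightarrow> snd (p X) \<in> (\<Inter>i\<in>I. X i)" "\<And>X. X \<in> \<X> \<Longrightarrow> s / w < dist (fst (p X)) (snd (p X))"
    by metis
  define v where "v X = sgn (snd (p X) - fst (p X))" for X
  have norm_v: "norm (v X) = 1" if "X \<in> \<X>" for X
  proof -
    have "0 < s / w"
      using s(1) w(1) by simp
    then have "fst (p X) \<noteq> snd (p X)"
      using p(3)[OF that] by force
    then show ?thesis by (simp add: v_def norm_sgn)
  qed
  have "\<X> \<noteq> {}"
    using \<X>(2) N_pos(1) \<alpha>(1) by (auto simp: mult_le_0_iff)
  then obtain X0 where "X0 \<in> \<X>" by blast
  \<comment> \<open>Applied to a single vector, averaging shows that \<open>\<gamma>(c)\<close>
      does not exceed one.\<close>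
  have "gamma_caps c \<le> 1"
  proof -
    obtain u where "gamma_caps c * real (card {X0}) \<le> real (card {X \<in> {X0}. w \<le> \<bar>u \<bullet> v X\<bar>})"
      using ex_direction_many_components_cart[of "{X0}" v c] norm_v[OF \<open>X0 \<in> \<X>\<close>] d
      by (auto simp: w_def)
    moreover have "card {X \<in> {X0}. w \<le> \<bar>u \<bullet> v X\<bar>} \<le> card {X0}"
      by (intro card_mono) auto
    ultimately show ?thesis by simp
  qed
  obtain u where u: "norm u \<le> 1" "gamma_caps c * real (card \<X>) \<le> real (card {X \<in> \<X>. w \<le> \<bar>u \<bullet> v X\<bar>})"
    using ex_direction_many_components_cart[of \<X> v c] \<X>(1) norm_v d by (auto simp: w_def)
  let ?Y = "{X \<in> Pi\<^sub>E I F. \<exists>x\<in>(\<Inter>k\<in>I. X k). \<exists>y\<in>(\<Inter>k\<in>I. X k). u \<bullet> (y - x) = s}"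
  have "X \<in> ?Y" if X: "X \<in> \<X>" "w \<le> \<bar>u \<bullet> v X\<bar>" for X
  proof -
    define x y where "x = fst (p X)" and "y = snd (p X)"
    have "v X = sgn (y - x)"
      by (simp add: v_def x_def y_def)
    then have "y - x = dist x y *\<^sub>R v X"
      by (cases "x = y") (simp_all add: sgn_div_norm dist_norm norm_minus_commute)
    then have "\<bar>u \<bullet> (y - x)\<bar> = dist x y * \<bar>u \<bullet> v X\<bar>"
      by (metis abs_mult abs_of_nonneg inner_scaleR_right zero_le_dist)
    moreover have "s / w * w \<le> dist x y * \<bar>u \<bullet> v X\<bar>"
      using X p(3)[OF X(1)] s w(1) by (intro mult_mono) (auto simp: x_def y_def)
    ultimately have "s \<le> \<bar>u \<bullet> (y - x)\<bar>"
      using w(1) by simp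
    moreover have "convex (\<Inter>k\<in>I. X k)"
      using X conv by (intro convex_INT) (auto simp: \<X>_def)
    ultimately obtain x' y' where "x' \<in> (\<Inter>k\<in>I. X k)" "y' \<in> (\<Inter>k\<in>I. X k)" "u \<bullet> (y' - x') = s"
      using segment_with_component[OF _ p(1,2)[OF X(1)] s(1), of u] unfolding x_def y_def by blast
    then show ?thesis
      using X(1) unfolding \<X>_def by blast
  qed
  then have "{X \<in> \<X>. w \<le> \<bar>u \<bullet> v X\<bar>} \<subseteq> ?Y"
    by blast
  then have "card {X \<in> \<X>. w \<le> \<bar>u \<bullet> v X\<bar>} \<le> card ?Y"
    using fin_tuples by (intro card_mono) simp
  moreover have "\<alpha> * gamma_caps c * real N \<le> gamma_caps c * real (card \<X>)"
    using mult_left_mono[OF \<X>(2), of "gamma_caps c"] \<gamma> \<alpha>(1) by (simp add: zero_less_mult_iff mult_ac)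
  ultimately have many': "\<alpha> * gamma_caps c * real (card (Pi\<^sub>E I F)) \<le> real (card ?Y)"
    using u(2) N_pos(2) by simp
  have "u \<noteq> 0"
  proof
    assume "u = 0"
    then have "?Y = {}" using s(1) by auto
    then have "\<alpha> * gamma_caps c * real N \<le> 0"
      using many' N_pos(2) by (metis card.empty of_nat_0)
    then show False
      using mult_pos_pos[OF \<gamma>, of "real N"] N_pos(1) by simp
  qed
  moreover have "\<alpha> * gamma_caps c \<le> 1"
    using mult_left_mono[OF \<open>gamma_caps c \<le> 1\<close>, of \<alpha>] \<alpha> by linarith
  ultimately obtain k G where G: "k \<in> I" "G \<subseteq> F k" "\<beta> * real (card (F k)) \<le> real (card G)"
    "\<exists>x\<in>\<Inter>G. \<exists>y\<in>\<Inter>G. u \<bullet> (y - x) = s"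
    using colourful_fractional_helly_width[of I u F "\<alpha> * gamma_caps c" s] I d(1) fin conv many'
    by (auto simp: \<beta>)
  then obtain x y where xy: "x \<in> \<Inter>G" "y \<in> \<Inter>G" "u \<bullet> (y - x) = s"
    by blast
  have "s \<le> norm u * dist x y"
    using norm_cauchy_schwarz[of u "y - x"] xy(3) by (simp add: dist_norm norm_minus_commute)
  also have "\<dots> \<le> 1 * dist x y"
    using u(1) by (intro mult_right_mono) auto
  finally have "ennreal s \<le> ediameter (\<Inter>G)"
    using dist_le_ediameter[OF xy(1,2)] by (auto intro: order_trans ennreal_leI)
  then show False
    using small'[OF G(1-3)] by simp
qed

end
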